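(* Let $n,s,k\ge 1$ and $r\ge 0$ be integers, and let $\mathcal{A}_1,\dots,\mathcal{A}_k\subset\mathbb{R}^n$ be affine subspaces, each of dimension at most $r$. Let $\bm{X}\in\mathbb{R}^{n\times s}$ be a real matrix each of whose columns belongs to the union $\mathcal{A}_1\cup\cdots\cup\mathcal{A}_k$. Then $$\operatorname{rank}\,\phi_d(\bm{X})\le k\binom{r+d}{d}\qquad\text{for all integers } d\ge 1.$$
   Context: For a vector $\bm{x}=(x_1,\dots,x_n)\in\mathbb{R}^n$ and an integer $d\ge 1$, $\phi_d(\bm{x})=(\bm{x}^{\bm{\alpha}})_{|\bm{\alpha}|\le d}\in\mathbb{R}^N$ is the vector of all monomials in $x_1,\dots,x_n$ of degree at most $d$. Here $\bm{\alpha}=(\alpha_1,\dots,\alpha_n)$ ranges over multi-indices of non-negative integers with $|\bm{\alpha}|:=\alpha_1+\cdots+\alpha_n\le d$, $\bm{x}^{\bm{\alpha}}:=x_1^{\alpha_1}\cdots x_n^{\alpha_n}$, and $N=\binom{n+d}{d}$. For a matrix $\bm{X}=[\bm{x}_1,\dots,\bm{x}_s]\in\mathbb{R}^{n\times s}$ with columns $\bm{x}_i$, $\phi_d(\bm{X})$ denotes the $N\times s$ real matrix $[\phi_d(\bm{x}_1),\dots,\phi_d(\bm{x}_s)]$. Affine subspaces are nonempty translates of linear subspaces. *)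

theory Defs
  imports "Jordan_Normal_Form.DL_Rank"
begin

text \<open>Multi-indices are lists of length \<open>n\<close>. They are enumerated in a fixed order,
  which determines the order of the entries of \<open>monomial_vec\<close>.\<close>

definition multi_indices :: "nat \<Rightarrow> nat \<Rightarrow> nat list list" where
  "multi_indices n d = filter (\<lambda>\<alpha>. sum_list \<alpha> \<le> d) (List.n_lists n [0..<Suc d])"

definition monomial :: "real vec \<Rightarrow> nat list \<Rightarrow> real" where
  "monomial x \<alpha> = (\<Prod>i<dim_vec x. x $ i ^ (\<alpha> ! i))"

definition monomial_vec :: "nat \<Rightarrow> real vec \<Rightarrow> real vec" where
  "monomial_vec d x = vec_of_list (map (monomial x) (multi_indices (dim_vec x) d))"

definition monomial_mat :: "nat \<Rightarrow> real mat \<Rightarrow> real mat" where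
  "monomial_mat d X =
     mat_of_cols ((dim_row X + d) choose d) (map (monomial_vec d) (cols X))"

lemma set_multi_indices: "set (multi_indices n d) = {\<alpha>. length \<alpha> = n \<and> sum_list \<alpha> \<le> d}"
proof -
  have "set \<alpha> \<subseteq> {0..<Suc d}" if "sum_list \<alpha> \<le> d" for \<alpha> :: "nat list"
    using member_le_sum_list[of _ \<alpha>] that by fastforce
  then show ?thesis
    by (auto simp: multi_indices_def set_n_lists simp del: upt_Suc)
qed

lemma distinct_multi_indices: "distinct (multi_indices n d)"
  by (simp add: multi_indices_def distinct_n_lists del: upt_Suc)

lemma length_multi_indices: "length (multi_indices n d) = (n + d) choose d"
proof -
  let ?S = "{\<alpha> :: nat list. length \<alpha> = n \<and> sum_list \<alpha> \<le> d}"
  let ?T = "{\<alpha> :: nat list. length \<alpha> = Suc n \<and> sum_list \<alpha> = d}"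
  have "bij_betw (\<lambda>\<alpha>. (d - sum_list \<alpha>) # \<alpha>) ?S ?T"
    by (rule bij_betw_byWitness[where f' = tl]) (auto simp: length_Suc_conv)
  then have "card ?S = card ?T"
    by (rule bij_betw_same_card)
  also have "\<dots> = (n + d) choose d"
    by (simp add: card_length_sum_list add.commute)
  finally show ?thesis
    using distinct_card[OF distinct_multi_indices, of n d] by (simp add: set_multi_indices)
qed

lemma dim_monomial_vec: "dim_vec (monomial_vec d x) = (dim_vec x + d) choose d"
  by (simp add: monomial_vec_def length_multi_indices)

lemma monomial_mat_carrier:
  "X \<in> carrier_mat n s \<Longrightarrow> monomial_mat d X \<in> carrier_mat ((n + d) choose d) s"
  by (auto simp: monomial_mat_def)

lemma col_monomial_mat:
  assumes "j < dim_col X"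
  shows "col (monomial_mat d X) j = monomial_vec d (col X j)"
proof -
  have "monomial_vec d (col X j) \<in> carrier_vec ((dim_row X + d) choose d)"
    by (rule carrier_vecI) (simp add: dim_monomial_vec)
  then show ?thesis
    using assms unfolding monomial_mat_def by (simp add: col_mat_of_cols)
qed

definition affine_subspace :: "nat \<Rightarrow> real vec set \<Rightarrow> bool" where
  "affine_subspace n A \<longleftrightarrow>
     (\<exists>a\<in>carrier_vec n. \<exists>W. VectorSpace.subspace class_ring W (module_vec TYPE(real) n) \<and>
        A = (\<lambda>w. a + w) ` W)"

definition affine_direction :: "real vec set \<Rightarrow> real vec set" where
  "affine_direction A = {x - y | x y. x \<in> A \<and> y \<in> A}"

definition affine_dim :: "nat \<Rightarrow> real vec set \<Rightarrow> nat" where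
  "affine_dim n A =
     vectorspace.dim class_ring ((module_vec TYPE(real) n)\<lparr>carrier := affine_direction A\<rparr>)"

lemma affine_direction_translate:
  assumes a: "a \<in> carrier_vec n"
    and W: "VectorSpace.subspace class_ring W (module_vec TYPE(real) n)"
  shows "affine_direction ((\<lambda>w. a + w) ` W) = W"
proof -
  interpret W: submodule class_ring W "module_vec TYPE(real) n"
    using W by (rule subspace.submod)
  have carr: "w \<in> carrier_vec n" if "w \<in> W" for w
    using W.subset that by (auto simp: module_vec_simps)
  have diff: "v - w \<in> W" if "v \<in> W" "w \<in> W" for v w
  proof -
    have "- 1 \<cdot>\<^sub>v w \<in> W"
      using W.smult_closed[of "- 1" w] that by (simp add: module_vec_simps)
    then have "v + - 1 \<cdot>\<^sub>v w \<in> W"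
      using W.m_closed[of v "- 1 \<cdot>\<^sub>v w"] that by (simp add: module_vec_simps)
    moreover have "v + - 1 \<cdot>\<^sub>v w = v - w"
      using carr that by (intro eq_vecI) auto
    ultimately show ?thesis by simp
  qed
  have cancel: "(a + v) - (a + w) = v - w" if "v \<in> W" "w \<in> W" for v w
    using a carr[OF that(1)] carr[OF that(2)] by (intro eq_vecI) auto
  have zero: "0\<^sub>v n \<in> W"
    using W.zero_closed by (simp add: module_vec_simps)
  show ?thesis
  proof (intro equalityI subsetI)
    fix x assume "x \<in> affine_direction ((\<lambda>w. a + w) ` W)"
    then show "x \<in> W"
      by (auto simp: affine_direction_def cancel diff)
  next
    fix x assume x: "x \<in> W"
    have "x = (a + x) - (a + 0\<^sub>v n)"
      using cancel[OF x zero] carr[OF x] by simp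
    with x zero show "x \<in> affine_direction ((\<lambda>w. a + w) ` W)"
      unfolding affine_direction_def by blast
  qed
qed

lemma affine_dim_translate:
  assumes "a \<in> carrier_vec n"
    and "VectorSpace.subspace class_ring W (module_vec TYPE(real) n)"
  shows "affine_dim n ((\<lambda>w. a + w) ` W) =
    vectorspace.dim class_ring ((module_vec TYPE(real) n)\<lparr>carrier := W\<rparr>)"
  unfolding affine_dim_def affine_direction_translate[OF assms] ..

end

theory Submission
  imports Defs
begin

text \<open>An affine subspace of dimension \<open>q\<close> is parametrised by an affine map \<open>c \<mapsto> x\<close> on \<open>\<real>\<^sup>q\<close>.
  Each monomial of degree at most \<open>d\<close> in the entries of \<open>x\<close> is then a polynomial of degree at
  most \<open>d\<close> in \<open>c\<close>, so \<open>\<phi>\<^sub>d x = M \<phi>\<^sub>d c\<close> for one matrix \<open>M\<close> with \<open>q + d choose d\<close> columns.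
  The columns of \<open>\<phi>\<^sub>d X\<close> therefore lie in the span of the columns of \<open>k\<close> such matrices.\<close>

section \<open>Polynomial functions of bounded degree\<close>

text \<open>Polynomiality is expressed through an explicit coefficient family indexed by
  multi-indices, since such a family later serves as one row of a matrix. Only the values on
  \<open>carrier_vec q\<close> are constrained.\<close>

definition poly_fun :: "nat \<Rightarrow> nat \<Rightarrow> (real vec \<Rightarrow> real) \<Rightarrow> bool" where
  "poly_fun q d f \<longleftrightarrow>
     (\<exists>C. \<forall>c\<in>carrier_vec q. f c = (\<Sum>\<beta>\<in>set (multi_indices q d). C \<beta> * monomial c \<beta>))"

lemma finite_multi_indices [simp]: "finite {\<alpha>. length \<alpha> = n \<and> sum_list \<alpha> \<le> (d :: nat)}"
  unfolding set_multi_indices[symmetric] by simp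

lemma poly_fun_monomial:
  assumes "length \<beta> = q" "sum_list \<beta> \<le> d"
  shows "poly_fun q d (\<lambda>c. monomial c \<beta>)"
  unfolding poly_fun_def set_multi_indices
  by (rule exI[of _ "\<lambda>\<alpha>. if \<alpha> = \<beta> then 1 else 0"])
    (use assms in \<open>simp add: if_distrib[of "\<lambda>x. x * _"] cong: if_cong\<close>)

lemma poly_fun_cong:
  assumes "\<And>c. c \<in> carrier_vec q \<Longrightarrow> f c = g c"
  shows "poly_fun q d f \<longleftrightarrow> poly_fun q d g"
  using assms unfolding poly_fun_def by simp

lemma poly_fun_zero: "poly_fun q d (\<lambda>_. 0)"
  unfolding poly_fun_def by (rule exI[of _ "\<lambda>_. 0"]) simp

lemma poly_fun_add:
  assumes "poly_fun q d f" "poly_fun q d g"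
  shows "poly_fun q d (\<lambda>c. f c + g c)"
proof -
  obtain C D where
    "\<forall>c\<in>carrier_vec q. f c = (\<Sum>\<beta>\<in>set (multi_indices q d). C \<beta> * monomial c \<beta>)"
    "\<forall>c\<in>carrier_vec q. g c = (\<Sum>\<beta>\<in>set (multi_indices q d). D \<beta> * monomial c \<beta>)"
    using assms unfolding poly_fun_def by blast
  then show ?thesis
    unfolding poly_fun_def
    by (intro exI[of _ "\<lambda>\<beta>. C \<beta> + D \<beta>"]) (simp add: sum.distrib distrib_right)
qed

lemma poly_fun_cmult:
  assumes "poly_fun q d f"
  shows "poly_fun q d (\<lambda>c. a * f c)"
proof -
  obtain C where
    "\<forall>c\<in>carrier_vec q. f c = (\<Sum>\<beta>\<in>set (multi_indices q d). C \<beta> * monomial c \<beta>)"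
    using assms unfolding poly_fun_def by blast
  then show ?thesis
    unfolding poly_fun_def
    by (intro exI[of _ "\<lambda>\<beta>. a * C \<beta>"]) (simp add: sum_distrib_left mult.assoc)
qed

lemma poly_fun_sum:
  assumes "\<And>i. i \<in> I \<Longrightarrow> poly_fun q d (f i)"
  shows "poly_fun q d (\<lambda>c. \<Sum>i\<in>I. f i c)"
  using assms
  by (induction I rule: infinite_finite_induct) (simp_all add: poly_fun_zero poly_fun_add)

lemma monomial_replicate_zero: "monomial c (replicate (dim_vec c) 0) = 1"
  by (simp add: monomial_def)

lemma monomial_unit:
  assumes "c \<in> carrier_vec q" "j < q"
  shows "monomial c ((replicate q 0)[j := 1]) = c $ j"
proof -
  have "monomial c ((replicate q 0)[j := 1]) = (\<Prod>i<q. if i = j then c $ j else 1)"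
    using assms unfolding monomial_def by (intro prod.cong) (auto simp: nth_list_update)
  then show ?thesis
    using assms by simp
qed

lemma poly_fun_one: "poly_fun q d (\<lambda>_. 1)"
proof -
  have "poly_fun q d (\<lambda>c. monomial c (replicate q 0))"
    by (rule poly_fun_monomial) (simp_all add: sum_list_replicate)
  moreover have "monomial c (replicate q 0) = 1" if "c \<in> carrier_vec q" for c
    using that monomial_replicate_zero[of c] by simp
  ultimately show ?thesis
    by (simp cong: poly_fun_cong)
qed

lemma poly_fun_coord:
  assumes "j < q" "d \<ge> 1"
  shows "poly_fun q d (\<lambda>c. c $ j)"
proof -
  have "poly_fun q d (\<lambda>c. monomial c ((replicate q 0)[j := 1]))"
    using assms by (intro poly_fun_monomial) (simp_all add: sum_list_update sum_list_replicate)
  then show ?thesis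
    using assms(1) poly_fun_cong[of q "\<lambda>c. monomial c ((replicate q 0)[j := 1])"]
    by (simp only: monomial_unit)
qed

lemma monomial_mult:
  assumes "length \<beta> = dim_vec c" "length \<gamma> = dim_vec c"
  shows "monomial c \<beta> * monomial c \<gamma> = monomial c (map2 (+) \<beta> \<gamma>)"
  using assms by (simp add: monomial_def prod.distrib power_add)

lemma sum_list_map2_add:
  "length xs = length ys \<Longrightarrow> sum_list (map2 (+) xs ys) = sum_list xs + (sum_list ys :: nat)"
  by (induction xs ys rule: list_induct2) simp_all

text \<open>Distributivity gives a double sum over pairs of exponents, and
  \<open>monomial_mult\<close> turns each term into a scalar times one monomial of degree at most
  \<open>d + e\<close>. Different pairs may yield the same exponent; closure under sums absorbs
  this, so the coefficients of the product are never computed.\<close>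

lemma poly_fun_mult:
  assumes "poly_fun q d f" "poly_fun q e g"
  shows "poly_fun q (d + e) (\<lambda>c. f c * g c)"
proof -
  obtain C D where
    C: "\<forall>c\<in>carrier_vec q. f c = (\<Sum>\<beta>\<in>set (multi_indices q d). C \<beta> * monomial c \<beta>)" and
    D: "\<forall>c\<in>carrier_vec q. g c = (\<Sum>\<gamma>\<in>set (multi_indices q e). D \<gamma> * monomial c \<gamma>)"
    using assms unfolding poly_fun_def by blast
  have "poly_fun q (d + e) (\<lambda>c. \<Sum>\<beta>\<in>set (multi_indices q d). \<Sum>\<gamma>\<in>set (multi_indices q e).
      (C \<beta> * D \<gamma>) * monomial c (map2 (+) \<beta> \<gamma>))"
    by (intro poly_fun_sum poly_fun_cmult poly_fun_monomial)
      (auto simp: set_multi_indices sum_list_map2_add)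
  moreover have "(\<Sum>\<beta>\<in>set (multi_indices q d). \<Sum>\<gamma>\<in>set (multi_indices q e).
      (C \<beta> * D \<gamma>) * monomial c (map2 (+) \<beta> \<gamma>)) = f c * g c" if c: "c \<in> carrier_vec q" for c
  proof -
    have "f c * g c = (\<Sum>\<beta>\<in>set (multi_indices q d). \<Sum>\<gamma>\<in>set (multi_indices q e).
        (C \<beta> * monomial c \<beta>) * (D \<gamma> * monomial c \<gamma>))"
      using C D c by (simp add: sum_product)
    also have "\<dots> = (\<Sum>\<beta>\<in>set (multi_indices q d). \<Sum>\<gamma>\<in>set (multi_indices q e).
        (C \<beta> * D \<gamma>) * monomial c (map2 (+) \<beta> \<gamma>))"
      using c by (intro sum.cong refl) (simp add: set_multi_indices monomial_mult[symmetric])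
    finally show ?thesis by simp
  qed
  ultimately show ?thesis
    by (simp cong: poly_fun_cong)
qed

lemma poly_fun_power:
  assumes "poly_fun q d f"
  shows "poly_fun q (m * d) (\<lambda>c. f c ^ m)"
  by (induction m) (simp_all add: poly_fun_one poly_fun_mult assms)

lemma poly_fun_prod:
  assumes "finite I" "\<And>i. i \<in> I \<Longrightarrow> poly_fun q (d i) (f i)"
  shows "poly_fun q (\<Sum>i\<in>I. d i) (\<lambda>c. \<Prod>i\<in>I. f i c)"
  using assms by (induction I rule: finite_induct) (simp_all add: poly_fun_one poly_fun_mult)

text \<open>Multiplying by the constant 1, taken as a polynomial function of degree at most
  \<open>e - d\<close>, raises the degree bound without changing the function.\<close>

lemma poly_fun_mono:
  assumes "poly_fun q d f" "d \<le> e"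
  shows "poly_fun q e f"
  using poly_fun_mult[OF assms(1) poly_fun_one[of q "e - d"]] assms(2) by simp

lemma poly_fun_affine: "poly_fun q 1 (\<lambda>c. a + (\<Sum>j<q. c $ j * b j))"
proof -
  \<comment> \<open>The constant and the products are arranged as scalar times function, the shape
    that \<open>poly_fun_cmult\<close> requires.\<close>
  have "poly_fun q 1 (\<lambda>c. a * 1 + (\<Sum>j<q. b j * c $ j))"
    by (intro poly_fun_add poly_fun_cmult poly_fun_sum poly_fun_one poly_fun_coord) auto
  then show ?thesis
    by (simp add: mult.commute)
qed

section \<open>Parametrisation of affine subspaces\<close>

text \<open>A maximal linearly independent subset of \<open>W\<close> is a basis of
  \<open>W\<close>, and its size is the dimension. The span in the conclusion is taken in the
  ambient space, so that linear combinations can be evaluated entry by entry.\<close>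

lemma subspace_finite_basis:
  assumes W: "VectorSpace.subspace class_ring W (module_vec TYPE(real) n)"
  obtains B where "finite B" "B \<subseteq> carrier_vec n"
    "card B = vectorspace.dim class_ring ((module_vec TYPE(real) n)\<lparr>carrier := W\<rparr>)"
    "LinearCombinations.module.span class_ring (module_vec TYPE(real) n) B = W"
proof -
  interpret V: vec_space "TYPE(real)" n .
  interpret W: vectorspace class_ring "V.vs W"
    by (rule V.subspace_is_vs[OF W])
  have sub: "submodule class_ring W V.V"
    using W by (rule subspace.submod)
  then have WC: "W \<subseteq> carrier_vec n"
    by (auto simp: submodule_def module_vec_simps)
  \<comment> \<open>Independence in \<open>W\<close> and in the ambient space agree, so the ambient
    dimension bounds every independent set. This bound makes a maximal one exist, with the empty set
    as the starting instance.\<close>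
  have "finite T \<and> card T \<le> V.dim" if "T \<subseteq> carrier (V.vs W) \<and> W.lin_indpt T" for T
  proof -
    have "V.lin_indpt T"
      using V.span_li_not_depend(2)[of T W] sub that by simp
    then show ?thesis
      using V.li_le_dim[of T] that WC subset_trans[of T W] by (simp add: module_vec_simps)
  qed
  moreover have "{} \<subseteq> carrier (V.vs W) \<and> W.lin_indpt {}"
    by (simp add: W.lin_dep_def)
  ultimately obtain B where B: "finite B" "maximal B (\<lambda>T. T \<subseteq> carrier (V.vs W) \<and> W.lin_indpt T)"
    using maximal_exists[of "\<lambda>T. T \<subseteq> carrier (V.vs W) \<and> W.lin_indpt T" V.dim "{}"] by blast
  then have basis: "W.basis B"
    by (intro W.max_li_is_basis)
  then have BW: "B \<subseteq> W" and "W.span B = W"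
    by (simp_all add: W.basis_def)
  then have "V.span B = W"
    using V.span_li_not_depend(1)[of B W] sub by simp
  with B(1) BW WC W.dim_basis[OF B(1) basis] show ?thesis
    by (intro that[of B]) auto
qed

text \<open>Here \<open>a\<close> is the translation vector and \<open>b\<close> enumerates a basis
  of the direction space, whose size is exactly \<open>affine_dim n A\<close>.\<close>

lemma affine_subspace_parametrisation:
  assumes "affine_subspace n A"
  obtains a b where
    "\<And>x. x \<in> A \<Longrightarrow> x \<in> carrier_vec n \<and> (\<exists>c\<in>carrier_vec (affine_dim n A). \<forall>i<n.
       x $ i = a $ i + (\<Sum>j<affine_dim n A. c $ j * b j $ i))"
proof -
  interpret V: vec_space "TYPE(real)" n .
  obtain a W where a: "a \<in> carrier_vec n"
    and W: "VectorSpace.subspace class_ring W V.V" and A: "A = (\<lambda>w. a + w) ` W"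
    using assms unfolding affine_subspace_def by blast
  obtain B where B: "finite B" "B \<subseteq> carrier_vec n" "V.span B = W"
    and card: "card B = affine_dim n A"
    using subspace_finite_basis[OF W] unfolding A affine_dim_translate[OF a W] by metis
  obtain b where b: "bij_betw b {..<affine_dim n A} B"
    using ex_bij_betw_nat_finite[OF B(1)] card by (auto simp: atLeast0LessThan)
  show thesis
  proof (rule that)
    fix x assume "x \<in> A"
    then obtain w where w: "w \<in> W" "x = a + w"
      using A by blast
    then have wC: "w \<in> carrier_vec n"
      using V.span_closed[of B w] B by (simp add: module_vec_simps)
    obtain f where f: "w = V.lincomb f B"
      using V.finite_in_span[of B w] B w(1) by (auto simp: module_vec_simps)
    \<comment> \<open>The coordinates of \<open>w\<close> in the basis \<open>B\<close>, listed in
      the order given by \<open>b\<close>.\<close>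
    define c where "c = vec (affine_dim n A) (\<lambda>j. f (b j))"
    have "x $ i = a $ i + (\<Sum>j<affine_dim n A. c $ j * b j $ i)" if "i < n" for i
    proof -
      have "w $ i = (\<Sum>v\<in>B. f v * v $ i)"
        unfolding f by (rule V.lincomb_index[OF that B(2)])
      also have "\<dots> = (\<Sum>j<affine_dim n A. f (b j) * b j $ i)"
        by (rule sum.reindex_bij_betw[OF b, symmetric])
      finally show ?thesis
        using that a wC w(2) by (simp add: c_def)
    qed
    moreover have "c \<in> carrier_vec (affine_dim n A)"
      by (simp add: c_def)
    ultimately show "x \<in> carrier_vec n \<and> (\<exists>c\<in>carrier_vec (affine_dim n A). \<forall>i<n.
       x $ i = a $ i + (\<Sum>j<affine_dim n A. c $ j * b j $ i))"
      using a wC w(2) by auto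
  qed
qed

section \<open>Factorisation of monomial vectors through a matrix\<close>

text \<open>The vector \<open>y\<close> is \<open>monomial_vec d c\<close> for the parameter
  \<open>c\<close> of \<open>x\<close>. The row of \<open>M\<close> at \<alpha> holds the
  coefficients of the monomial \<alpha> of \<open>x\<close>, read as a polynomial in
  \<open>c\<close>; it depends on \<open>A\<close> alone, so one \<open>M\<close> serves all
  points.\<close>

lemma monomial_vec_affine_subspace:
  assumes "affine_subspace n A"
  shows "\<exists>M\<in>carrier_mat ((n + d) choose d) ((affine_dim n A + d) choose d).
    \<forall>x\<in>A. \<exists>y\<in>carrier_vec ((affine_dim n A + d) choose d). monomial_vec d x = M *\<^sub>v y"
proof -
  define q where "q = affine_dim n A"
  obtain a b where param: "\<And>x. x \<in> A \<Longrightarrow> x \<in> carrier_vec n \<and> (\<exists>c\<in>carrier_vec q. \<forall>i<n.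
       x $ i = a $ i + (\<Sum>j<q. c $ j * b j $ i))"
    using affine_subspace_parametrisation[OF assms] unfolding q_def by blast
  have "poly_fun q d (\<lambda>c. \<Prod>i<n. (a $ i + (\<Sum>j<q. c $ j * b j $ i)) ^ (\<alpha> ! i))"
    if "\<alpha> \<in> set (multi_indices n d)" for \<alpha>
  proof -
    \<comment> \<open>Each factor is a power of an affine function of degree 1; the factor 1 in the
      sum matches the form of \<open>poly_fun_power\<close>. The sum is the total degree of
      \<alpha>.\<close>
    have "poly_fun q (\<Sum>i<n. \<alpha> ! i * 1)
        (\<lambda>c. \<Prod>i<n. (a $ i + (\<Sum>j<q. c $ j * b j $ i)) ^ (\<alpha> ! i))"
      by (intro poly_fun_prod poly_fun_power poly_fun_affine) simp
    moreover have "(\<Sum>i<n. \<alpha> ! i * 1) \<le> d"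
      using that by (auto simp: set_multi_indices sum_list_sum_nth atLeast0LessThan)
    ultimately show ?thesis
      by (rule poly_fun_mono)
  qed
  then have "\<forall>\<alpha>\<in>set (multi_indices n d). \<exists>C. \<forall>c\<in>carrier_vec q.
      (\<Prod>i<n. (a $ i + (\<Sum>j<q. c $ j * b j $ i)) ^ (\<alpha> ! i)) =
      (\<Sum>\<beta>\<in>set (multi_indices q d). C \<beta> * monomial c \<beta>)"
    unfolding poly_fun_def by blast
  \<comment> \<open>The coefficients are chosen per \<alpha> and before \<open>c\<close>, which is
    what allows them to be collected into a single matrix.\<close>
  from bchoice[OF this] obtain C where C: "\<forall>\<alpha>\<in>set (multi_indices n d). \<forall>c\<in>carrier_vec q.
      (\<Prod>i<n. (a $ i + (\<Sum>j<q. c $ j * b j $ i)) ^ (\<alpha> ! i)) =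
      (\<Sum>\<beta>\<in>set (multi_indices q d). C \<alpha> \<beta> * monomial c \<beta>)"
    by blast
  define M where "M = mat ((n + d) choose d) ((q + d) choose d)
    (\<lambda>(l, m). C (multi_indices n d ! l) (multi_indices q d ! m))"
  show ?thesis
    unfolding q_def[symmetric]
  proof (intro bexI[of _ M] ballI)
    show "M \<in> carrier_mat ((n + d) choose d) ((q + d) choose d)"
      by (simp add: M_def)
    fix x assume "x \<in> A"
    then obtain c where x: "x \<in> carrier_vec n" and c: "c \<in> carrier_vec q"
      and eq: "\<forall>i<n. x $ i = a $ i + (\<Sum>j<q. c $ j * b j $ i)"
      using param by blast
    have dim: "dim_vec (monomial_vec d c) = (q + d) choose d"
      using c dim_monomial_vec[of d c] by simp
    have "monomial_vec d x = M *\<^sub>v monomial_vec d c"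
    proof (rule eq_vecI)
      show "dim_vec (monomial_vec d x) = dim_vec (M *\<^sub>v monomial_vec d c)"
        using x by (simp add: dim_monomial_vec M_def)
      fix l assume "l < dim_vec (M *\<^sub>v monomial_vec d c)"
      then have l: "l < (n + d) choose d"
        by (simp add: M_def)
      let ?\<alpha> = "multi_indices n d ! l"
      have "monomial_vec d x $ l = monomial x ?\<alpha>"
        using l x by (simp add: monomial_vec_def vec_of_list_index length_multi_indices)
      also have "\<dots> = (\<Prod>i<n. (a $ i + (\<Sum>j<q. c $ j * b j $ i)) ^ (?\<alpha> ! i))"
        using x eq by (simp add: monomial_def)
      also have "\<dots> = (\<Sum>\<beta>\<in>set (multi_indices q d). C ?\<alpha> \<beta> * monomial c \<beta>)"
        using l c by (intro C[rule_format]) (simp_all add: length_multi_indices)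
      \<comment> \<open>Distinctness of the enumeration turns the sum over multi-indices into a sum
        over positions, as in a matrix-vector product.\<close>
      also have "\<dots> = (\<Sum>m<(q + d) choose d.
          C ?\<alpha> (multi_indices q d ! m) * monomial c (multi_indices q d ! m))"
        using sum.reindex_bij_betw[OF bij_betw_nth[OF distinct_multi_indices refl refl],
            of "\<lambda>\<beta>. C ?\<alpha> \<beta> * monomial c \<beta>" q d]
        by (simp add: length_multi_indices)
      also have "\<dots> = (M *\<^sub>v monomial_vec d c) $ l"
        using l c dim
        by (simp add: M_def scalar_prod_def atLeast0LessThan monomial_vec_def vec_of_list_index
            length_multi_indices)
      finally show "monomial_vec d x $ l = (M *\<^sub>v monomial_vec d c) $ l" .
    qed
    then show "\<exists>y\<in>carrier_vec ((q + d) choose d). monomial_vec d x = M *\<^sub>v y"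
      using dim by (intro bexI[of _ "monomial_vec d c"] carrier_vecI)
  qed
qed

section \<open>Rank bound from a spanning set\<close>

text \<open>The rank is the size of a maximal independent set of columns, and Steinitz exchange
  bounds the size of an independent set in \<open>span T\<close> by \<open>card T\<close>.\<close>

lemma (in vec_space) rank_le_card_spanning:
  assumes "A \<in> carrier_mat n nc" "finite T" "T \<subseteq> carrier_vec n" "set (cols A) \<subseteq> span T"
  shows "rank A \<le> card T"
proof -
  obtain S where S: "finite S" "maximal S (\<lambda>U. U \<subseteq> set (cols A) \<and> lin_indpt U)"
    using maximal_exists_superset[of "set (cols A)" "\<lambda>U. U \<subseteq> set (cols A) \<and> lin_indpt U" "{}"]
    by (auto simp: lin_dep_def)
  then have "S \<subseteq> span T" "lin_indpt S"
    using assms(4) by (auto simp: maximal_def)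
  then have "card S \<le> card T"
    \<comment> \<open>Exchange completes \<open>S\<close> to a generating set of
      \<open>span T\<close> by at most \<open>card T - card S\<close> further vectors, a difference
      of integers that is therefore nonnegative.\<close>
    using replacement[OF S(1) assms(2), unfolded module_vec_simps] assms(3) by fastforce
  then show ?thesis
    using rank_card_indpt[OF assms(1) S(2)] by simp
qed

theorem proposition2:
  fixes n s k r :: nat
    and A :: "nat \<Rightarrow> real vec set"
    and X :: "real mat"
  assumes "n \<ge> 1" and "s \<ge> 1" and "k \<ge> 1"
    and "\<And>i. i < k \<Longrightarrow> affine_subspace n (A i)"
    and "\<And>i. i < k \<Longrightarrow> affine_dim n (A i) \<le> r"
    and "X \<in> carrier_mat n s"
    and "\<And>j. j < s \<Longrightarrow> col X j \<in> (\<Union>i<k. A i)"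
  shows "\<forall>d\<ge>1. vec_space.rank ((n + d) choose d) (monomial_mat d X) \<le> k * ((r + d) choose d)"
proof (intro allI impI)
  fix d :: nat
  interpret V: vec_space "TYPE(real)" "(n + d) choose d" .
  have "\<forall>i\<in>{..<k}. \<exists>M. M \<in> carrier_mat ((n + d) choose d) ((affine_dim n (A i) + d) choose d) \<and>
      (\<forall>x\<in>A i. \<exists>y\<in>carrier_vec ((affine_dim n (A i) + d) choose d). monomial_vec d x = M *\<^sub>v y)"
    using monomial_vec_affine_subspace[OF assms(4)] unfolding Bex_def by simp
  from bchoice[OF this] obtain M where M_all:
    "\<forall>i\<in>{..<k}. M i \<in> carrier_mat ((n + d) choose d) ((affine_dim n (A i) + d) choose d) \<and>
      (\<forall>x\<in>A i. \<exists>y\<in>carrier_vec ((affine_dim n (A i) + d) choose d). monomial_vec d x = M i *\<^sub>v y)"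
    ..
  have M: "M i \<in> carrier_mat ((n + d) choose d) ((affine_dim n (A i) + d) choose d)"
    and eq: "x \<in> A i \<Longrightarrow> \<exists>y\<in>carrier_vec ((affine_dim n (A i) + d) choose d).
      monomial_vec d x = M i *\<^sub>v y" if "i < k" for i x
    using bspec[OF M_all, of i] that by simp_all
  \<comment> \<open>All columns of the \<open>k\<close> matrices together; this finite set spans
    every monomial vector of a point in the union.\<close>
  define T where "T = (\<Union>i<k. set (cols (M i)))"
  have T: "T \<subseteq> carrier_vec ((n + d) choose d)"
    unfolding T_def
  proof (rule UN_least)
    fix i assume "i \<in> {..<k}"
    then have "dim_row (M i) = (n + d) choose d"
      using M[of i] by simp
    then show "set (cols (M i)) \<subseteq> carrier_vec ((n + d) choose d)"
      using cols_dim[of "M i"] by metis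
  qed
  have in_span: "monomial_vec d x \<in> V.span T" if i: "i < k" and x: "x \<in> A i" for i x
  proof -
    \<comment> \<open>The column space of \<open>M i\<close> is the set of all products of
      \<open>M i\<close> with a vector, and \<open>eq\<close> exhibits such a product.\<close>
    have "monomial_vec d x \<in> V.col_space (M i)"
      unfolding V.col_space_eq[OF M[OF i]] using eq[OF i x] M[OF i] by auto
    moreover have "V.span (set (cols (M i))) \<subseteq> V.span T"
      by (rule V.span_is_monotone) (use i in \<open>auto simp: T_def\<close>)
    ultimately show ?thesis
      by (auto simp: V.col_space_def)
  qed
  have "set (cols (monomial_mat d X)) \<subseteq> V.span T"
  proof
    fix v assume "v \<in> set (cols (monomial_mat d X))"
    then obtain j where j: "j < s" "v = col (monomial_mat d X) j"
      using monomial_mat_carrier[OF assms(6), of d] by (auto simp: cols_def)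
    then have "v = monomial_vec d (col X j)"
      using assms(6) by (simp add: col_monomial_mat)
    moreover obtain i where "i < k" "col X j \<in> A i"
      using assms(7)[OF j(1)] by blast
    ultimately show "v \<in> V.span T"
      using in_span by simp
  qed
  then have "V.rank (monomial_mat d X) \<le> card T"
    using V.rank_le_card_spanning[OF monomial_mat_carrier[OF assms(6)] _ T] by (simp add: T_def)
  also have "\<dots> \<le> (\<Sum>i<k. card (set (cols (M i))))"
    unfolding T_def by (rule card_UN_le) simp
  also have "\<dots> \<le> (\<Sum>i<k. (r + d) choose d)"
  proof (rule sum_mono)
    fix i assume i: "i \<in> {..<k}"
    \<comment> \<open>Repeated columns can only make the set smaller than the number of columns. The
      bound \<open>r\<close> on the dimension then enters through monotonicity of the binomial
      coefficient in its upper argument.\<close>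
    have "card (set (cols (M i))) \<le> (affine_dim n (A i) + d) choose d"
      using card_length[of "cols (M i)"] carrier_matD(2)[OF M, of i] i by simp
    also have "\<dots> \<le> (r + d) choose d"
      using assms(5) i by (intro binomial_right_mono) simp
    finally show "card (set (cols (M i))) \<le> (r + d) choose d" .
  qed
  finally show "V.rank (monomial_mat d X) \<le> k * ((r + d) choose d)"
    by simp
qed

end
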